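(* Let $n$ be a positive integer and let $\beta_n$ be a positive root (in $x$) of the equation $$\left(e^{1+n}-x(-1+n)\right)^2-\left(e^{2+2n}n-x^2n+xe^{1+n}(1-n+n^2)\right)\ln\left(e+e^{-n}x\right)=0.$$ Let $\beta$ be a real number with $\beta>\beta_n$. If $p\in\mathcal{H}_1$ satisfies $$p(z)+\beta\frac{zp'(z)}{p^{n+1}(z)}\prec e^z,$$ then $p(z)\prec e^z$.
   Context: $\mathbb{D}=\{z\in\mathbb{C}:|z|<1\}$. $\mathcal{H}_1$ is the class of analytic functions on $\mathbb{D}$ of the form $p(z)=1+a_1z+a_2z^2+\cdots$. $p^{k}(z)$ means $(p(z))^{k}$; $\ln$ is the real natural logarithm. For functions $F,G$ analytic in $\mathbb{D}$, $F\prec G$ (F is subordinate to G) means there is an analytic $w:\mathbb{D}\to\mathbb{C}$ with $w(0)=0$, $|w(z)|<1$ and $F(z)=G(w(z))$ for all $z\in\mathbb{D}$; writing $F\prec G$ presupposes that $F$ and $G$ are analytic in $\mathbb{D}$. *)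

theory Defs
  imports "HOL-Complex_Analysis.Complex_Analysis"
begin

definition class_H1 :: "(complex \<Rightarrow> complex) set" where
  "class_H1 = {p. p holomorphic_on ball 0 1 \<and> p 0 = 1}"

definition subordinate :: "(complex \<Rightarrow> complex) \<Rightarrow> (complex \<Rightarrow> complex) \<Rightarrow> bool"
    (infix "\<prec>\<^sub>s" 50) where
  "F \<prec>\<^sub>s G \<longleftrightarrow>
     F holomorphic_on ball 0 1 \<and> G holomorphic_on ball 0 1 \<and>
     (\<exists>w. w holomorphic_on ball 0 1 \<and> w 0 = 0 \<and>
          (\<forall>z\<in>ball 0 1. norm (w z) < 1 \<and> F z = G (w z)))"

end

theory Submission imports Defs
begin

text \<open>
  The left-hand side does not vanish, so \<open>p = exp g\<close> with \<open>g 0 = 0\<close>, and the claim is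
  \<open>\<bar>g\<bar> < 1\<close>. Otherwise, at a point \<open>z0\<close> of least modulus with \<open>\<bar>g z0\<bar> = 1\<close>, Jack's lemma gives
  \<open>z0 g'(z0) = m \<zeta>\<close> with \<open>\<zeta> = g z0\<close> and \<open>m \<ge> 1\<close>, and the left-hand side there equals
  \<open>exp \<zeta> + \<beta> m \<zeta> exp (- n \<zeta>)\<close>. This has modulus at least \<open>e\<close>, whereas values of \<open>exp\<close> on the
  open unit disc have modulus less than \<open>e\<close>. In terms of \<open>t = \<beta>\<^sub>n exp (- (n + 1))\<close> the only
  consequence of the equation for \<open>\<beta>\<^sub>n\<close> that is needed is \<open>t > 13/10\<close>, \<open>t > 3/2\<close>, \<open>t > 2\<close> for
  \<open>n = 1\<close>, \<open>n = 2\<close>, \<open>n \<ge> 3\<close>. For \<open>n \<ge> 3\<close> the triangle inequality then suffices; for smaller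
  \<open>n\<close> it fails only near \<open>\<zeta> = 1\<close>, where the two summands enclose an acute angle.
\<close>

section \<open>Lower bounds for the normalised root\<close>

lemma half_le_ln_one_plus:
  fixes t :: real
  assumes "0 \<le> t" "t \<le> 2"
  shows "t / 2 \<le> ln (1 + t)"
proof -
  have "exp (t / 2) \<le> 1 + t / 2 + (t / 2)\<^sup>2"
    using assms by (intro exp_bound) auto
  also have "\<dots> \<le> 1 + t"
    using assms mult_nonneg_nonneg[of t "2 - t"] by (simp add: power2_eq_square field_simps)
  finally show ?thesis
    using assms by (subst ln_ge_iff) auto
qed

text \<open>\<open>root\<close> is the equation for \<open>\<beta>\<^sub>n\<close> divided by
  \<open>exp (2 + 2 * n)\<close>, with \<open>k = n\<close>. Were \<open>t\<close> at most the
  claimed bound, the factor of the logarithm would be nonnegative, so \<open>ln (1 + t)\<close>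
  could be lowered to \<open>t/2\<close>; the polynomial inequality \<open>le\<close> obtained in
  this way is false.\<close>

lemma root_lower_bound:
  fixes t k :: real
  assumes "t > 0"
    and root: "(1 - t * (k - 1))\<^sup>2 = (k - t\<^sup>2 * k + t * (1 - k + k\<^sup>2)) * (1 + ln (1 + t))"
  shows "k = 1 \<Longrightarrow> t > 13/10" "k = 2 \<Longrightarrow> t > 3/2" "k \<ge> 3 \<Longrightarrow> t > 2"
proof -
  have ln_ge: "1 + t/2 \<le> 1 + ln (1 + t)" if "t \<le> 2"
    using half_le_ln_one_plus[of t] that assms(1) by simp
  have le: "(k - t\<^sup>2 * k + t * (1 - k + k\<^sup>2)) * (1 + t/2) \<le> (1 - t * (k - 1))\<^sup>2"
    if "t \<le> 2" "0 \<le> k - t\<^sup>2 * k + t * (1 - k + k\<^sup>2)"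
    unfolding root using that ln_ge by (intro mult_left_mono) auto
  show "t > 13/10" if "k = 1"
  proof (rule ccontr)
    assume "\<not> t > 13/10"
    then have t: "t \<le> 13/10" by simp
    \<comment> \<open>Here \<open>le\<close> amounts to \<open>t * (3 - t - t * t) \<le> 0\<close>,
      and 13/10 lies just below the positive zero (sqrt 13 - 1)/2 of the bracket.\<close>
    have "t * t \<le> 13/10 * t"
      using t assms(1) by (intro mult_right_mono) auto
    then have "3 - t - t * t > 0" and "1 - t * t + t \<ge> 0"
      using t assms(1) by linarith+
    moreover from this have "t * (3 - t - t * t) > 0"
      using assms(1) by (intro mult_pos_pos)
    moreover have "(1 - t\<^sup>2 + t) * (1 + t/2) = 1 + t * (3 - t - t * t) / 2"
      by (simp add: power2_eq_square field_simps)
    ultimately show False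
      using le t that by (simp add: power2_eq_square)
  qed
  show "t > 3/2" if "k = 2"
  proof (rule ccontr)
    assume "\<not> t > 3/2"
    then have t: "t \<le> 3/2" by simp
    have a: "t * (3 - 2 * t) \<ge> 0" using t assms(1) by simp
    have eq: "k - t\<^sup>2 * k + t * (1 - k + k\<^sup>2) = 2 + t * (3 - 2 * t)"
      using that by (simp add: power2_eq_square algebra_simps)
    have "(2 + t * (3 - 2 * t)) * (1 + t/2) \<le> (1 - t)\<^sup>2"
      using le[unfolded eq] t a that by simp
    moreover have "(2 + t * (3 - 2 * t)) * (1 + t/2) \<ge> 2 * 1"
      using a assms(1) by (intro mult_mono) auto
    moreover have "(1 - t)\<^sup>2 \<le> 1"
      using t assms(1) by (simp add: abs_square_le_1)
    ultimately show False
      by simp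
  qed
  show "t > 2" if k: "k \<ge> 3"
  proof (rule ccontr)
    assume "\<not> t > 2"
    then have t: "t \<le> 2" by simp
    \<comment> \<open>Grouped so that each bracket is nonnegative for \<open>k \<ge> 3\<close> and
      \<open>0 < t \<le> 2\<close>; the regrouping of the difference below follows the same
      plan.\<close>
    have q: "k - t\<^sup>2 * k + t * (1 - k + k\<^sup>2) = k * (1 + t * (2 - t)) + t * (1 + k * (k - 3))"
      by (simp add: power2_eq_square algebra_simps)
    have "0 \<le> k - t\<^sup>2 * k + t * (1 - k + k\<^sup>2)"
      unfolding q using k t assms(1) by (intro add_nonneg_nonneg mult_nonneg_nonneg) auto
    from le[OF t this] have
      "(k - t\<^sup>2 * k + t * (1 - k + k\<^sup>2)) * (1 + t/2) - (1 - t * (k - 1))\<^sup>2 \<le> 0" by simp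
    also have "(k - t\<^sup>2 * k + t * (1 - k + k\<^sup>2)) * (1 + t/2) - (1 - t * (k - 1))\<^sup>2
        = (k - 1) + (k/2 - 2) * t + (t * (2 - t)) * ((k\<^sup>2 - k + 1) / 2) + (t * (2 - t)) * ((2 + t) * (k / 2))"
      by (simp add: power2_eq_square field_simps)
    finally have "(k - 1) + (k/2 - 2) * t + (t * (2 - t)) * ((k\<^sup>2 - k + 1) / 2) + (t * (2 - t)) * ((2 + t) * (k / 2)) \<le> 0" .
    moreover have "(t * (2 - t)) * ((k\<^sup>2 - k + 1) / 2) \<ge> 0"
      using t k assms(1) by (intro mult_nonneg_nonneg) (auto simp: power2_eq_square)
    moreover have "(t * (2 - t)) * ((2 + t) * (k / 2)) \<ge> 0"
      using t k assms(1) by (intro mult_nonneg_nonneg) auto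
    moreover have "(k - 1) + (k/2 - 2) * t = (k - 3) * (1 + t/2) + (2 - t/2)"
      by (simp add: field_simps)
    moreover have "(k - 3) * (1 + t/2) \<ge> 0" using k assms(1) by simp
    ultimately show False using t by linarith
  qed
qed

section \<open>The modulus bound on the unit circle\<close>

lemma norm_add_ge_right_if_inner_nonneg:
  fixes u v :: "'a :: real_inner"
  assumes "inner u v \<ge> 0"
  shows "norm v \<le> norm (u + v)"
  using assms by (simp add: norm_le inner_add inner_commute)

text \<open>With \<open>x = (n + 1) * Im \<zeta>\<close>, the inner product is a nonnegative
  multiple of \<open>Re \<zeta> * cos x + Im \<zeta> * sin x\<close>. The constant 3/2 is a rational
  below pi/2, so \<open>cos x \<ge> 0\<close> and \<open>sin x\<close> has the sign of
  \<open>Im \<zeta>\<close>.\<close>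

lemma inner_exp_nonneg:
  fixes \<zeta> :: complex and n :: nat and b :: real
  assumes "b \<ge> 0" "Re \<zeta> \<ge> 0" "(n + 1) * \<bar>Im \<zeta>\<bar> \<le> 3/2"
  shows "inner (exp \<zeta>) (of_real b * \<zeta> * exp (- of_nat n * \<zeta>)) \<ge> 0"
proof -
  define x where "x = (n + 1) * Im \<zeta>"
  have x: "\<bar>x\<bar> \<le> 3/2"
    using assms(3) by (simp add: x_def abs_mult)
  have "cos x \<ge> 0"
    using x pi_gt3 by (intro cos_ge_zero) auto
  have sgn: "Im \<zeta> * sin x \<ge> 0"
  proof (cases "Im \<zeta> \<ge> 0")
    case True
    then have "x \<ge> 0" by (simp add: x_def)
    then show ?thesis using True x pi_gt3 by (intro mult_nonneg_nonneg sin_ge_zero) auto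
  next
    case False
    then have "x \<le> 0" by (simp add: x_def mult_nonneg_nonpos)
    then have "sin (- x) \<ge> 0" using x pi_gt3 by (intro sin_ge_zero) auto
    then show ?thesis using False by (intro mult_nonpos_nonpos) auto
  qed
  have "inner (exp \<zeta>) (of_real b * \<zeta> * exp (- of_nat n * \<zeta>))
      = Re (cnj (exp \<zeta>) * (of_real b * \<zeta> * exp (- of_nat n * \<zeta>)))"
    by (simp add: inner_complex_def)
  also have "cnj (exp \<zeta>) * (of_real b * \<zeta> * exp (- of_nat n * \<zeta>))
      = of_real b * \<zeta> * exp (cnj \<zeta> - of_nat n * \<zeta>)"
    by (simp add: exp_cnj exp_diff exp_minus field_simps)
  also have "Re \<dots> = b * exp (Re \<zeta> - n * Re \<zeta>) * (Re \<zeta> * cos x + Im \<zeta> * sin x)"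
    by (simp add: Re_exp Im_exp x_def algebra_simps sin_add cos_add sin_diff cos_diff)
  also have "\<dots> \<ge> 0"
    using assms \<open>cos x \<ge> 0\<close> sgn by (intro mult_nonneg_nonneg[of "b * _"] add_nonneg_nonneg) auto
  finally show ?thesis .
qed

lemma exp_one_le_norm:
  fixes \<zeta> :: complex and n :: nat and t :: real
  assumes \<zeta>: "norm \<zeta> = 1" and "n > 0"
    and t: "n = 1 \<Longrightarrow> t \<ge> 13/10" "n = 2 \<Longrightarrow> t \<ge> 3/2" "n \<ge> 3 \<Longrightarrow> t \<ge> 2"
  shows "exp 1 \<le> norm (exp \<zeta> + of_real (t * exp (1 + real n)) * \<zeta> * exp (- of_nat n * \<zeta>))"
proof -
  let ?v = "of_real (t * exp (1 + real n)) * \<zeta> * exp (- of_nat n * \<zeta>)"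
  define d where "d = 1 - Re \<zeta>"
  have d: "d \<ge> 0" using abs_Re_le_cmod[of \<zeta>] \<zeta> by (simp add: d_def)
  have t1: "t \<ge> 1"
  proof -
    consider "n = 1" | "n = 2" | "n \<ge> 3" using \<open>n > 0\<close> by linarith
    then show ?thesis using t by cases auto
  qed
  have sq: "(Re \<zeta>)\<^sup>2 + (Im \<zeta>)\<^sup>2 = 1"
    using cmod_power2[of \<zeta>] \<zeta> by simp
  have v: "norm ?v = exp 1 * (t * exp (n * d))"
    using t1 \<zeta> by (simp add: norm_mult d_def algebra_simps flip: exp_add)
  have u: "norm (exp \<zeta>) = exp 1 * exp (- d)"
    by (simp add: d_def flip: exp_add)
  \<comment> \<open>The triangle inequality. The left side of the difference criterion grows with
    \<open>d\<close>, so a lower bound for \<open>exp d\<close> settles it.\<close>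
  have direct: ?thesis if "1 \<le> t * exp (n * d) - exp (- d)"
  proof -
    have "exp 1 * 1 \<le> exp 1 * (t * exp (n * d) - exp (- d))"
      using that by (intro mult_left_mono) auto
    also have "\<dots> = norm ?v - norm (exp \<zeta>)"
      unfolding u v by (simp add: algebra_simps)
    also have "\<dots> \<le> norm (exp \<zeta> + ?v)"
      using norm_diff_ineq[of ?v "exp \<zeta>"] by (simp add: add.commute)
    finally show ?thesis by simp
  qed
  \<comment> \<open>The second summand alone has modulus at least e, and adding a vector at an acute
    angle does not shorten it.\<close>
  have aligned: ?thesis if "Re \<zeta> \<ge> 0" "(n + 1) * \<bar>Im \<zeta>\<bar> \<le> 3/2"
  proof -
    have "1 * 1 \<le> t * exp (n * d)"
      using t1 d by (intro mult_mono) auto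
    then have "exp 1 \<le> norm ?v"
      unfolding v by simp
    also have "\<dots> \<le> norm (exp \<zeta> + ?v)"
      using that t1 by (intro norm_add_ge_right_if_inner_nonneg inner_exp_nonneg) auto
    finally show ?thesis .
  qed
  consider "n = 1" | "n = 2" | "n \<ge> 3" using \<open>n > 0\<close> by linarith
  then show ?thesis
  proof cases
    case 1
    show ?thesis
    \<comment> \<open>The cut at 2/3 serves both sides: 1 - 4/9 < (3/4)^2 near 1, and 13/10 * 25/18
      - 18/25 > 1 away from it.\<close>
    proof (cases "Re \<zeta> \<ge> 2/3")
      case True
      have "(2/3)\<^sup>2 \<le> (Re \<zeta>)\<^sup>2" using True by (intro power_mono) auto
      then have "\<bar>Im \<zeta>\<bar>\<^sup>2 \<le> (3/4)\<^sup>2" using sq by (simp add: power2_eq_square)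
      then have "\<bar>Im \<zeta>\<bar> \<le> 3/4" by (rule power2_le_imp_le) simp
      then show ?thesis using True 1 by (intro aligned) auto
    next
      case False
      then have "1/3 \<le> d" by (simp add: d_def)
      \<comment> \<open>The linear bound 4/3 would be too weak: 13/10 * 4/3 - 3/4 < 1.\<close>
      have "1 + 1/3 + (1/3)\<^sup>2 / 2 \<le> exp (1/3::real)" by (rule exp_lower_Taylor_quadratic) simp
      also have "\<dots> \<le> exp d" using \<open>1/3 \<le> d\<close> by simp
      finally have e: "25/18 \<le> exp d" by (simp add: power2_eq_square)
      then have "inverse (exp d) \<le> inverse (25/18)" by (intro le_imp_inverse_le) auto
      moreover have "13/10 * (25/18) \<le> t * exp d" using e t 1 by (intro mult_mono) auto
      ultimately show ?thesis using 1 by (intro direct) (simp add: exp_minus)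
    qed
  next
    case 2
    show ?thesis
    \<comment> \<open>Likewise 1 - 49/64 < (1/2)^2, and 3/2 * (9/8)^2 - 8/9 > 1.\<close>
    proof (cases "Re \<zeta> \<ge> 7/8")
      case True
      have "(7/8)\<^sup>2 \<le> (Re \<zeta>)\<^sup>2" using True by (intro power_mono) auto
      then have "\<bar>Im \<zeta>\<bar>\<^sup>2 \<le> (1/2)\<^sup>2" using sq by (simp add: power2_eq_square)
      then have "\<bar>Im \<zeta>\<bar> \<le> 1/2" by (rule power2_le_imp_le) simp
      then show ?thesis using True 2 by (intro aligned) auto
    next
      case False
      then have e: "9/8 \<le> exp d" using exp_ge_add_one_self[of d] unfolding d_def by linarith
      then have "inverse (exp d) \<le> inverse (9/8)" by (intro le_imp_inverse_le) auto
      moreover have "3/2 * (9/8 * (9/8)) \<le> t * (exp d * exp d)"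
        using e t 2 by (intro mult_mono) auto
      ultimately show ?thesis using 2 by (intro direct) (simp add: exp_minus exp_double power2_eq_square)
    qed
  next
    case 3
    have "2 * 1 \<le> t * exp (n * d)" using t 3 d by (intro mult_mono) auto
    moreover have "exp (- d) \<le> 1" using d by simp
    ultimately show ?thesis by (intro direct) linarith
  qed
qed

section \<open>Jack's lemma and the first boundary point\<close>

text \<open>Rescaling gives a self-map \<open>h\<close> of the disc with \<open>h 0 = 0\<close>,
  \<open>h 1 = 1\<close> and derivative \<open>D\<close> at 1. Maximality of \<open>Re h\<close>
  along the circle makes \<open>D\<close> real; the Schwarz lemma along the radius makes it at least
  1.\<close>

lemma jack:
  assumes holo: "g holomorphic_on S" and S: "open S" "cball 0 (norm z0) \<subseteq> S"
    and "z0 \<noteq> 0" and "g 0 = 0"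
    and max: "\<And>z. norm z < norm z0 \<Longrightarrow> norm (g z) < norm (g z0)"
  obtains m :: real where "m \<ge> 1" "z0 * deriv g z0 = of_real m * g z0"
proof
  have gz0: "g z0 \<noteq> 0"
    using max[of 0] \<open>z0 \<noteq> 0\<close> \<open>g 0 = 0\<close> by auto
  define h where "h = (\<lambda>w. g (z0 * w) / g z0)"
  define D where "D = z0 * deriv g z0 / g z0"
  have in_S: "z0 * w \<in> S" if "norm w \<le> 1" for w
    using that S(2) mult_left_le[of "norm w" "norm z0"] by (auto simp: norm_mult)
  have "(g has_field_derivative deriv g z0) (at (z0 * 1))"
    using holomorphic_derivI[OF holo S(1)] in_S[of 1] by simp
  then have h1: "(h has_field_derivative D) (at 1)"
    unfolding h_def D_def
    by (auto intro!: derivative_eq_intros DERIV_chain2[of g] simp: gz0)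
  have holoh: "h holomorphic_on ball 0 1"
    unfolding h_def using gz0 in_S
    by (intro holomorphic_intros holomorphic_on_compose_gen[OF _ holo, unfolded o_def]) auto
  have conth: "continuous_on (cball 0 1) h"
    unfolding h_def using gz0 in_S
    by (intro continuous_intros continuous_on_compose2[OF holomorphic_on_imp_continuous_on[OF holo]]) auto
  have "norm (h w) < 1" if "norm w < 1" for w
    using max[of "z0 * w"] that \<open>z0 \<noteq> 0\<close> gz0 by (simp add: h_def norm_mult norm_divide)
  then have schwarz: "norm (h w) \<le> norm w" if "norm w < 1" for w
    using Schwarz_Lemma(1)[OF holoh _ _ that] \<open>g 0 = 0\<close> by (auto simp: h_def)
  have "norm (h w) \<le> 1" if "norm w \<le> 1" for w
  proof (rule continuous_on_closure_norm_le[of "ball 0 1" h])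
    show "\<forall>y\<in>ball 0 1. norm (h y) \<le> 1"
      using schwarz by force
  qed (use conth that in auto)
  then have Re_le: "Re (h w) \<le> 1" if "norm w \<le> 1" for w
    using that complex_Re_le_cmod[of "h w"] by force
  have path: "((\<lambda>s. Re (h (\<gamma> s))) has_real_derivative Re (\<gamma>' * D)) (at t)"
    if "(\<gamma> has_vector_derivative \<gamma>') (at t)" "\<gamma> t = 1" for \<gamma> \<gamma>' t
    using field_vector_diff_chain_at[OF that(1), of h D] h1 that(2)
    by (intro has_field_derivative_Re) (simp add: o_def)
  have "h 1 = 1"
    using gz0 by (simp add: h_def)

  \<comment> \<open>Tangential direction: \<open>Re (\<i> * D)\<close> is
    \<open>- Im D\<close>.\<close>
  have "((\<lambda>s. Re (h (cis s))) has_real_derivative Re (\<i> * D)) (at 0)"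
    by (rule path) (auto simp: has_vector_derivative_complex_iff intro!: derivative_eq_intros)
  moreover have "\<forall>s. \<bar>0 - s\<bar> < 1 \<longrightarrow> Re (h (cis s)) \<le> Re (h (cis 0))"
    using Re_le \<open>h 1 = 1\<close> by simp
  ultimately have "Re (\<i> * D) = 0"
    by (rule DERIV_local_max[OF _ zero_less_one])
  then have "D = of_real (Re D)"
    by (simp add: complex_eq_iff)
  then show "z0 * deriv g z0 = of_real (Re D) * g z0"
    using gz0 by (simp add: D_def field_simps)

  show "Re D \<ge> 1"
  proof (rule ccontr)
    assume "\<not> Re D \<ge> 1"
    \<comment> \<open>Radial direction: if \<open>Re D < 1\<close>, then \<open>s - Re (h s)\<close>
      increases through 0 at 1, so it is negative just before 1, against Schwarz.\<close>
    have "((\<lambda>s. Re (h (of_real s))) has_real_derivative Re (1 * D)) (at 1)"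
      by (rule path) (auto intro!: derivative_eq_intros)
    then have "((\<lambda>s. s - Re (h (of_real s))) has_real_derivative 1 - Re D) (at 1)"
      by (intro DERIV_diff DERIV_ident) simp
    from DERIV_pos_inc_left[OF this] \<open>\<not> Re D \<ge> 1\<close> obtain d where
      d: "d > 0" "\<And>e. 0 < e \<Longrightarrow> e < d \<Longrightarrow> (1 - e) - Re (h (of_real (1 - e))) < 0"
      using \<open>h 1 = 1\<close> by auto
    define e where "e = min (d/2) (1/2)"
    have e: "0 < e" "e < d" "e < 1" using d(1) by (auto simp: e_def)
    have "Re (h (of_real (1 - e))) \<le> norm (of_real (1 - e) :: complex)"
      using schwarz[of "of_real (1 - e)"] complex_Re_le_cmod[of "h (of_real (1 - e))"] e
      by (simp del: of_real_diff)
    with d(2)[of e] e show False by (simp del: of_real_diff)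
  qed
qed

text \<open>A point of least modulus in the compact set \<open>K\<close> works:
  \<open>norm (g z) < 1\<close> on the smaller open disc, and continuity gives
  \<open>norm (g z0) \<le> 1\<close>.\<close>

lemma first_boundary_point:
  fixes g :: "complex \<Rightarrow> complex"
  assumes cont: "continuous_on (ball 0 R) g" and "g 0 = 0"
    and z1: "z1 \<in> ball 0 R" "norm (g z1) \<ge> 1"
  obtains z0 where "z0 \<in> ball 0 R" "z0 \<noteq> 0" "norm (g z0) = 1"
    "\<And>z. norm z < norm z0 \<Longrightarrow> norm (g z) < 1"
proof -
  define K where "K = {z \<in> cball 0 (norm z1). norm (g z) \<in> {1..}}"
  have cont': "continuous_on (cball 0 r) g" if "r < R" for r
    using that by (intro continuous_on_subset[OF cont]) auto
  have "closed K"
    unfolding K_def using z1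
    by (intro continuous_closed_preimage[unfolded vimage_def Int_def mem_Collect_eq]
        continuous_intros cont') auto
  moreover have "bounded K"
    by (rule bounded_subset[OF bounded_cball[of 0 "norm z1"]]) (auto simp: K_def)
  ultimately have "compact K"
    by (simp add: compact_eq_bounded_closed)
  moreover have "z1 \<in> K"
    using z1 by (simp add: K_def)
  ultimately obtain z0 where z0: "z0 \<in> K" "\<And>z. z \<in> K \<Longrightarrow> norm z0 \<le> norm z"
    using continuous_attains_inf[of K norm] by (auto intro: continuous_intros)
  have less: "norm (g z) < 1" if "norm z < norm z0" for z
    using z0(1) z0(2)[of z] that by (force simp: K_def)
  have R: "norm z0 < R" using z0(1) z1 by (simp add: K_def)
  have "z0 \<noteq> 0" using z0(1) \<open>g 0 = 0\<close> by (auto simp: K_def)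
  have "norm (g z0) \<le> 1"
  proof (rule continuous_on_closure_norm_le[of "ball 0 (norm z0)" g])
    show "\<forall>y\<in>ball 0 (norm z0). norm (g y) \<le> 1" using less by force
  qed (use \<open>z0 \<noteq> 0\<close> cont'[OF R] in auto)
  then have "norm (g z0) = 1" using z0(1) by (simp add: K_def)
  then show thesis using that R \<open>z0 \<noteq> 0\<close> less by simp
qed

section \<open>Assembling the subordination\<close>

theorem theorem4p5:
  fixes n :: nat and \<beta>\<^sub>n \<beta> :: real and p :: "complex \<Rightarrow> complex"
  assumes "n > 0"
    and "\<beta>\<^sub>n > 0"
    and "(exp (1 + real n) - \<beta>\<^sub>n * (-1 + real n))\<^sup>2
         - (exp (2 + 2 * real n) * real n - \<beta>\<^sub>n\<^sup>2 * real n
            + \<beta>\<^sub>n * exp (1 + real n) * (1 - real n + (real n)\<^sup>2))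
           * ln (exp 1 + exp (- real n) * \<beta>\<^sub>n) = 0"
    and "\<beta> > \<beta>\<^sub>n"
    and "p \<in> class_H1"
    and "(\<lambda>z. p z + complex_of_real \<beta> * (z * deriv p z / p z ^ (n + 1))) \<prec>\<^sub>s exp"
  shows "p \<prec>\<^sub>s exp"
proof -
  define E where "E = exp (1 + real n)"
  define t where "t = \<beta>\<^sub>n / E"
  have "E > 0" by (simp add: E_def)
  have "t > 0" using assms(2) by (simp add: t_def E_def)
  have \<beta>\<^sub>n: "\<beta>\<^sub>n = t * E" using \<open>E > 0\<close> by (simp add: t_def)
  have "exp 1 + exp (- real n) * \<beta>\<^sub>n = exp 1 * (1 + t)"
    by (simp add: \<beta>\<^sub>n E_def field_simps flip: exp_add)
  then have ln: "ln (exp 1 + exp (- real n) * \<beta>\<^sub>n) = 1 + ln (1 + t)"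
    using \<open>t > 0\<close> by (simp add: ln_mult)
  have "exp (2 + 2 * real n) = E\<^sup>2"
    by (simp add: E_def power2_eq_square flip: exp_add)
  with assms(3) have "0 = (E - t * E * (real n - 1))\<^sup>2
      - (E\<^sup>2 * real n - (t * E)\<^sup>2 * real n + t * E * E * (1 - real n + (real n)\<^sup>2)) * (1 + ln (1 + t))"
    unfolding ln by (simp add: E_def[symmetric] \<beta>\<^sub>n)
  also have "\<dots> = E\<^sup>2 * ((1 - t * (real n - 1))\<^sup>2
      - (real n - t\<^sup>2 * real n + t * (1 - real n + (real n)\<^sup>2)) * (1 + ln (1 + t)))"
    by (simp add: power2_eq_square algebra_simps)
  finally have "E\<^sup>2 * ((1 - t * (real n - 1))\<^sup>2
      - (real n - t\<^sup>2 * real n + t * (1 - real n + (real n)\<^sup>2)) * (1 + ln (1 + t))) = 0" ..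
  then have root: "(1 - t * (real n - 1))\<^sup>2
      = (real n - t\<^sup>2 * real n + t * (1 - real n + (real n)\<^sup>2)) * (1 + ln (1 + t))"
    using \<open>E > 0\<close> by simp
  note t = root_lower_bound[OF \<open>t > 0\<close> root]

  define F where "F = (\<lambda>z. p z + complex_of_real \<beta> * (z * deriv p z / p z ^ (n + 1)))"
  obtain w where w: "\<And>z. z \<in> ball 0 1 \<Longrightarrow> norm (w z) < 1 \<and> F z = exp (w z)"
    using assms(6) unfolding F_def subordinate_def by blast
  have p: "p holomorphic_on ball 0 1" "p 0 = 1"
    using assms(5) by (auto simp: class_H1_def)
  \<comment> \<open>At a zero of \<open>p\<close> the convention \<open>x / 0 = 0\<close> gives \<open>F z = 0\<close>.\<close>
  have "p z \<noteq> 0" if "z \<in> ball 0 1" for z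
  proof
    assume "p z = 0"
    then have "F z = 0" by (simp add: F_def)
    with w[OF that] show False by simp
  qed
  then obtain g\<^sub>0 where g\<^sub>0: "g\<^sub>0 holomorphic_on ball 0 1" "\<And>z. z \<in> ball 0 1 \<Longrightarrow> exp (g\<^sub>0 z) = p z"
    using holomorphic_logarithm_exists[of "ball 0 1" p 0] p(1) by auto
  \<comment> \<open>Since \<open>p 0 = 1\<close>, the constant removed is a multiple of 2 pi i, so
    \<open>g\<close> is still a logarithm of \<open>p\<close>.\<close>
  define g where "g = (\<lambda>z. g\<^sub>0 z - g\<^sub>0 0)"
  have g: "g holomorphic_on ball 0 1" "g 0 = 0"
    unfolding g_def by (auto intro!: holomorphic_intros g\<^sub>0(1))
  have pg: "p z = exp (g z)" if "z \<in> ball 0 1" for z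
    using g\<^sub>0(2)[OF that] g\<^sub>0(2)[of 0] p(2) by (simp add: g_def exp_diff)
  have F: "F z = exp (g z) + of_real \<beta> * (z * deriv g z) * exp (- of_nat n * g z)"
    if z: "z \<in> ball 0 1" for z
  proof -
    have "((\<lambda>z. exp (g z)) has_field_derivative exp (g z) * deriv g z) (at z)"
      by (intro DERIV_fun_exp holomorphic_derivI[OF g(1) open_ball z])
    then have "(p has_field_derivative exp (g z) * deriv g z) (at z)"
      by (rule has_field_derivative_transform_within_open[OF _ open_ball z]) (simp add: pg)
    then have "deriv p z = exp (g z) * deriv g z" by (rule DERIV_imp_deriv)
    moreover have "exp (g z) ^ n = exp (of_nat n * g z)" by (simp add: exp_of_nat_mult)
    ultimately show ?thesis
      by (simp add: F_def pg[OF z] exp_minus field_simps)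
  qed
  have "norm (g z) < 1" if z: "z \<in> ball 0 1" for z
  proof (rule ccontr)
    assume "\<not> norm (g z) < 1"
    then obtain z0 where z0: "z0 \<in> ball 0 1" "z0 \<noteq> 0" "norm (g z0) = 1"
      "\<And>z. norm z < norm z0 \<Longrightarrow> norm (g z) < 1"
      using first_boundary_point[OF holomorphic_on_imp_continuous_on[OF g(1)] g(2) z]
      by (auto simp: not_less)
    obtain m :: real where m: "m \<ge> 1" "z0 * deriv g z0 = of_real m * g z0"
    proof (rule jack[OF g(1) open_ball _ z0(2) g(2)])
      show "cball 0 (norm z0) \<subseteq> ball 0 1" using z0(1) by auto
    qed (use z0(3,4) in auto)
    \<comment> \<open>Chosen so that \<open>\<beta> * m = T * E\<close>; the modulus bound is
      applied with \<open>T\<close> in place of \<open>t\<close>.\<close>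
    define T where "T = \<beta> * m / E"
    have "t \<le> \<beta> / E"
      using assms(4) \<open>E > 0\<close> by (simp add: t_def divide_right_mono)
    also have "\<dots> \<le> T"
      using m(1) assms(2,4) \<open>E > 0\<close> by (simp add: T_def divide_right_mono)
    finally have "t \<le> T" .
    have "exp 1 \<le> norm (exp (g z0) + of_real (T * exp (1 + real n)) * g z0 * exp (- of_nat n * g z0))"
      using t \<open>t \<le> T\<close> by (intro exp_one_le_norm z0(3) assms(1)) auto
    also have "\<dots> = norm (F z0)"
      using \<open>E > 0\<close> by (simp add: F[OF z0(1)] m(2) T_def E_def mult.assoc)
    also have "\<dots> = exp (Re (w z0))"
      using w[OF z0(1)] by simp
    also have "\<dots> < exp 1"
      using w[OF z0(1)] complex_Re_le_cmod[of "w z0"] by simp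
    finally show False by simp
  qed
  \<comment> \<open>The logarithm \<open>g\<close> is itself the Schwarz function of the
    subordination.\<close>
  with g p(1) pg show ?thesis
    unfolding subordinate_def by (intro conjI exI[of _ g] holomorphic_intros) auto
qed

end
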